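(* Both of the following fail: (1) (Prawitz's conjecture) every inference rule $\mathscr{R}$ of the form $\{\langle \langle \mathscr{D}_1, \dots, \mathscr{D}_n \rangle, A, \emptyset \rangle \mid \mathscr{D}_i \text{ for } A_i,\ i \leq n\}$ which is logically valid relative to some set of reductions $\mathfrak{J}$ is derivable in intuitionistic propositional logic $\texttt{IL}$; (2) $\texttt{IL}$ is complete over $\models$, i.e. for all finite sets $\Gamma$ of formulas and all formulas $A$, $\Gamma \models A$ implies $\Gamma \vdash_{\texttt{IL}} A$.
   Context: Language. Formulas of $\mathscr{L}$: $A ::= p_1, p_2, \dots \mid \bot \mid A \wedge A \mid A \vee A \mid A \rightarrow A$. Atoms: the $p_i$'s and $\bot$. $\vdash_{\texttt{IL}}$ is derivability in intuitionistic propositional logic. A rule $\mathscr{R}$ is derivable in $\texttt{IL}$ when, for all $\Gamma, A$, $A$ is derivable from $\Gamma$ in the extension of $\texttt{IL}$ by $\mathscr{R}$ only if $A$ is derivable from $\Gamma$ already in $\texttt{IL}$. Atomic rules. Level $0$: an axiom with no premises and an atom $A$ as conclusion. Level $1$: premises atoms $A_1,\dots,A_n$, conclusion an atom $A$. Level $k+2$: premises atoms $A_1,\dots,A_n$, conclusion an atom $A$, where the application may discharge, above premise $A_i$, assumed atomic rules belonging to a finite (possibly empty) set $\Re_i$; $k$ is the maximal level of rules in the $\Re_i$'s. An atomic base is a set $\mathfrak{B} = \{\mathfrak{r}_1,\dots,\mathfrak{r}_n\} \cup \texttt{AE}$, with $\mathfrak{r}_i$ atomic rules and $\texttt{AE}$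 the set of all rules with premise $\bot$ and conclusion an atom $A$. $\mathfrak{C}$ is an extension of $\mathfrak{B}$ iff $\mathfrak{C} \supseteq \mathfrak{B}$. Atomic derivations are generated inductively: an application of a level-$0$ rule (an axiom node $A$) is an atomic derivation; from atomic derivations of the premises of an atomic rule one obtains an atomic derivation of its conclusion by applying the rule, discharging above the $i$-th premise applications of rules in $\Re_i$. (So all top-nodes are axioms; there are no assumed formulas.) $\texttt{DER}_\mathfrak{B}$ is the set of atomic derivations all of whose applied and undischarged rules belong to $\mathfrak{B}$; $\mathscr{D} \in \texttt{DER}_\mathfrak{B}$ with conclusion $A$ witnesses $\vdash_\mathfrak{B} A$. Argument structures. An argument structure is a pair $\langle T, \langle f,h,g\rangle\rangle$: $T$ is a finite rooted tree with order $\prec$ (towards the root) and nodes labelled by formulas, whose top-nodes are partitioned into assumptions $T^{\texttt{As}}$ and axioms $T^{\texttt{Ax}}$; $f$ (discharge of assumptions) is defined on some $G \subseteq T^{\texttt{As}}$ with $\mu \prec f(\mu)$; $h$ (discharge of level-$0$ rules) is defined on some $H \subseteq T^{\texttt{Ax}}$, where for $\mu \in H$, $\mu$ is labelled by an atom, $\mu \prec h(\mu)$, $h(\mu)$ and its children are labelled by atoms and $h(\mu) \neq f(\nu)$ for all $\nu \in G$; $g$ (discharge of rules of higher level) is defined on some set $J$ of sets $K$ of edges, each $K$ consisting of all and only the edges linking a node $\mu_K$ to its children, with $\mu_K$ and its children labelled by atoms, $\mu_K \neq f(\nu)$ for all $\nu\in G$, $\mu_K \prec g(K)$, $g(K)$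 and its children labelled by atoms, and $g(K) \neq f(\nu)$ for all $\nu \in G$. The root label is the conclusion. The structure is closed iff all assumptions are discharged, open otherwise. It is from $\Gamma$ to $A$ (or for $A$) if $\Gamma$ is the set of its undischarged assumption-formulas and $A$ its conclusion. Sub-structures and replacement $\mathscr{D}[\mathscr{D}^{**}/\mathscr{D}^*]$ of sub-structures are as usual in Natural Deduction, with discharges readjusted in the obvious way. For $\mathscr{D}$ from $\Gamma=\{A_1,\dots,A_n\}$ and a function $\sigma$ assigning to each $A_i$ an argument structure $\sigma(A_i)$ for $A_i$, $\mathscr{D}^\sigma = \mathscr{D}[\sigma(A_1),\dots,\sigma(A_n)/A_1,\dots,A_n]$. Inferences. An inference is a triple $\langle\langle \mathscr{D}_1,\dots,\mathscr{D}_n\rangle, A, \delta\rangle$, with $\delta$ extending the discharge functions of the $\mathscr{D}_i$'s; its associated argument structure is obtained by joining the $\mathscr{D}_i$'s by a new root $A$, with discharges given by $\delta$ ($\delta=\emptyset$: no new discharges). An inference rule is a set of inferences (its instances), identified with the set of associated argument structures. $\mathscr{D}$ is canonical iff it is associated to an instance of a standard Natural Deduction introduction rule (for $\wedge,\vee,\rightarrow$; $\rightarrow_I$ may discharge vacuously). Reductions. A reduction for an inference rule $\mathscr{R}$ is a constructive (effectively computable) function $\phi$ from argument structures to argument structures, defined on some $\mathbb{D} \subseteq \mathscr{R}$, such that for all $\sigma$: $\mathscr{D}\in\mathbb{D}$ implies $\mathscr{D}^\sigma \in \mathbb{D}$; if $\mathscr{D} \in \mathbb{D}$ is from $\Gamma$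 to $A$ then $\phi(\mathscr{D})$ is from some $\Gamma^*\subseteq\Gamma$ to $A$; and $\phi(\mathscr{D}^\sigma)=\phi(\mathscr{D})^\sigma$. For a set $\mathfrak{J}$ of reductions, $\mathscr{D}$ immediately reduces to $\mathscr{D}^*$ relative to $\mathfrak{J}$ iff $\mathscr{D}^*=\mathscr{D}[\phi(\mathscr{D}^{**})/\mathscr{D}^{**}]$ for some sub-structure $\mathscr{D}^{**}$ of $\mathscr{D}$ and some $\phi\in\mathfrak{J}$; $\leq_\mathfrak{J}$ is the reflexive-transitive closure. Validity. $\langle\mathscr{D},\mathfrak{J}\rangle$ is valid on $\mathfrak{B}$ iff: (1) if $\mathscr{D}$ is closed with atomic conclusion $A$, then $\mathscr{D}\leq_\mathfrak{J}\mathscr{D}^*$ for some $\mathscr{D}^*$ witnessing $\vdash_\mathfrak{B} A$; (2) if $\mathscr{D}$ is closed with non-atomic conclusion, then $\mathscr{D}\leq_\mathfrak{J}\mathscr{D}^*$ for some canonical $\mathscr{D}^*$ whose immediate sub-structures are valid on $\mathfrak{B}$ when paired with $\mathfrak{J}$; (3) if $\mathscr{D}$ is open with undischarged assumptions $A_1,\dots,A_n$, then for all $\sigma$ (with $\sigma(A_i)$ closed), all sets of reductions $\mathfrak{H}\supseteq\mathfrak{J}$ and all $\mathfrak{C}\supseteq\mathfrak{B}$, if every $\langle\sigma(A_i),\mathfrak{H}\rangle$ is valid on $\mathfrak{C}$, then $\langle\mathscr{D}^\sigma,\mathfrak{H}\rangle$ is valid on $\mathfrak{C}$. $\langle\mathscr{D},\mathfrak{J}\rangle$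 is logically valid iff it is valid on every $\mathfrak{B}$. $\Gamma\models A$ iff there is a logically valid $\langle\mathscr{D},\mathfrak{J}\rangle$ with $\mathscr{D}$ from $\Gamma$ to $A$. Validity of rules. $\mathscr{R}$ is valid relative to $\mathfrak{J}$ on $\mathfrak{B}$ iff for all $\mathfrak{H}\supseteq\mathfrak{J}$, all $\mathfrak{C}\supseteq\mathfrak{B}$ and every instance $\langle\langle\mathscr{D}_1,\dots,\mathscr{D}_n\rangle,A,\delta\rangle$ of $\mathscr{R}$, if all $\langle\mathscr{D}_i,\mathfrak{H}\rangle$ are valid on $\mathfrak{C}$, then the associated argument structure is valid on $\mathfrak{C}$ when paired with $\mathfrak{H}$. $\mathscr{R}$ is logically valid relative to $\mathfrak{J}$ iff it is valid relative to $\mathfrak{J}$ on every $\mathfrak{B}$. *)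

theory Defs
  imports Main "HOL-Library.FSet" "HOL-Library.Nat_Bijection"
begin

section \<open>Formulas, atomic rules and atomic bases\<close>

datatype atom = Var nat | Bot

datatype formula =
    Atom atom
  | Conj formula formula
  | Disj formula formula
  | Impl formula formula

fun is_atomic :: "formula \<Rightarrow> bool" where
  "is_atomic (Atom a) = True"
| "is_atomic _ = False"

text \<open>
  \<open>ARule [(\<RR>\<^sub>1, A\<^sub>1), \<dots>, (\<RR>\<^sub>n, A\<^sub>n)] A\<close> is the rule with premises \<open>A\<^sub>i\<close> and conclusion \<open>A\<close> that
  may discharge rules from \<open>\<RR>\<^sub>i\<close> above its \<open>i\<close>-th premise. Level 0 is \<open>n = 0\<close>; level 1 is the case
  where \<open>n > 0\<close> and all \<open>\<RR>\<^sub>i\<close> are empty. Being a datatype, it contains exactly the rules of finite level.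
\<close>

datatype arule = ARule "(arule fset \<times> atom) list" atom

definition AE :: "arule set" where
  "AE = {ARule [({||}, Bot)] a | a. True}"

definition atomic_base :: "arule set \<Rightarrow> bool" where
  "atomic_base \<BB> \<longleftrightarrow> (\<exists>R. finite R \<and> \<BB> = R \<union> AE)"


section \<open>Argument structures\<close>

text \<open>
  Trees are finitely branching with ordered premises. A leaf \<open>Assm A d\<close> is an assumption, a leaf
  \<open>Node A d []\<close> is an axiom. The three discharge functions are stored at the nodes they are
  applied to: the \<open>d\<close> of an assumption is the value of \<open>f\<close>, the \<open>d\<close> of an axiom that of \<open>h\<close>, and
  the \<open>d\<close> of an inner node \<open>\<mu>\<close> that of \<open>g\<close> at the set of edges linking \<open>\<mu>\<close> to its children. \<open>None\<close>
  means undefined (not discharged), and \<open>Some k\<close> refers to the \<open>k\<close>-th node strictly below on the way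
  to the root (\<open>Some 0\<close> being the parent).
\<close>

datatype astruct =
    Assm formula "nat option"
  | Node formula "nat option" "astruct list"

fun concl :: "astruct \<Rightarrow> formula" where
  "concl (Assm A d) = A"
| "concl (Node A d ts) = A"

text \<open>
  The formulas of the assumptions in a tree that are discharged at its \<open>n\<close>-th ancestor.
\<close>

fun dis_by :: "nat \<Rightarrow> astruct \<Rightarrow> formula set" where
  "dis_by n (Assm A d) = (if d = Some n then {A} else {})"
| "dis_by n (Node A d ts) = (\<Union>t\<in>set ts. dis_by (Suc n) t)"

text \<open>
  The condition imposed both on the nodes that can be discharged by \<open>h\<close> or \<open>g\<close> and on the nodes
  that can be values of \<open>h\<close> or \<open>g\<close>: the node and its children are labelled by atoms, and the node is
  not a value of \<open>f\<close>.
\<close>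

fun atomic_node :: "astruct \<Rightarrow> bool" where
  "atomic_node (Assm A d) = False"
| "atomic_node (Node A d ts) =
     (is_atomic A \<and> (\<forall>t\<in>set ts. is_atomic (concl t) \<and> dis_by 0 t = {}))"

text \<open>
  \<open>env\<close> lists, for the nodes below (parent first), whether they satisfy \<open>atomic_node\<close>.
\<close>

fun wf_struct :: "bool list \<Rightarrow> astruct \<Rightarrow> bool" where
  "wf_struct env (Assm A d) = (\<forall>k. d = Some k \<longrightarrow> k < length env)"
| "wf_struct env (Node A d ts) =
     ((\<forall>k. d = Some k \<longrightarrow> atomic_node (Node A d ts) \<and> k < length env \<and> env ! k) \<and>
      (\<forall>t\<in>set ts. wf_struct (atomic_node (Node A d ts) # env) t))"

definition arg_struct :: "astruct \<Rightarrow> bool" where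
  "arg_struct D \<longleftrightarrow> wf_struct [] D"

definition struct_for :: "astruct \<Rightarrow> formula \<Rightarrow> bool" where
  "struct_for D A \<longleftrightarrow> arg_struct D \<and> concl D = A"

fun assms_of :: "astruct \<Rightarrow> formula set" where
  "assms_of (Assm A d) = (if d = None then {A} else {})"
| "assms_of (Node A d ts) = (\<Union>t\<in>set ts. assms_of t)"

abbreviation closed_struct :: "astruct \<Rightarrow> bool" where
  "closed_struct D \<equiv> assms_of D = {}"

fun subst :: "(formula \<Rightarrow> astruct) \<Rightarrow> astruct \<Rightarrow> astruct" where
  "subst \<sigma> (Assm A d) = (if d = None then \<sigma> A else Assm A d)"
| "subst \<sigma> (Node A d ts) = Node A d (map (subst \<sigma>) ts)"

text \<open>
  If \<open>t\<close> is a subtree of an argument structure, \<open>prune 0 t\<close> is the corresponding sub-structure: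
  whatever was discharged at a node outside \<open>t\<close> becomes undischarged.
\<close>

fun prune :: "nat \<Rightarrow> astruct \<Rightarrow> astruct" where
  "prune n (Assm A d) = Assm A (Option.bind d (\<lambda>k. if k < n then Some k else None))"
| "prune n (Node A d ts) =
     Node A (Option.bind d (\<lambda>k. if k < n then Some k else None)) (map (prune (Suc n)) ts)"

fun immediate_subs :: "astruct \<Rightarrow> astruct list" where
  "immediate_subs (Assm A d) = []"
| "immediate_subs (Node A d ts) = map (prune 0) ts"


section \<open>Atomic derivations\<close>

text \<open>
  \<open>env\<close> lists, for the rule applications below (closest first), the set of rules these may discharge
  above the premise under consideration.
\<close>

inductive atomic_deriv :: "arule set \<Rightarrow> arule fset list \<Rightarrow> astruct \<Rightarrow> bool"
  for \<BB> :: "arule set" where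
  "\<lbrakk> list_all2 (\<lambda>q t. concl t = Atom (snd q) \<and> atomic_deriv \<BB> (fst q # env) t) qs ts;
     case d of None \<Rightarrow> ARule qs a \<in> \<BB>
             | Some k \<Rightarrow> k < length env \<and> ARule qs a |\<in>| env ! k \<rbrakk>
   \<Longrightarrow> atomic_deriv \<BB> env (Node (Atom a) d ts)"

definition DER :: "arule set \<Rightarrow> astruct set" where
  "DER \<BB> = {D. atomic_deriv \<BB> [] D}"


section \<open>Inferences and inference rules\<close>

text \<open>
  An inference is represented by its associated argument structure \<open>D\<close>: the premises are
  \<open>immediate_subs D\<close>, the conclusion is \<open>concl D\<close>, and the new discharges are those made at the root.
  In particular \<open>Node A None [D\<^sub>1, \<dots>, D\<^sub>n]\<close> with argument structures \<open>D\<^sub>i\<close> has no new discharges.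
\<close>

definition inference_rule :: "astruct set \<Rightarrow> bool" where
  "inference_rule R \<longleftrightarrow> (\<forall>D\<in>R. arg_struct D \<and> (\<exists>A ts. D = Node A None ts))"

definition schematic_rule :: "formula list \<Rightarrow> formula \<Rightarrow> astruct set" where
  "schematic_rule As A = {Node A None Ds | Ds. list_all2 struct_for Ds As}"

inductive_set intro_rules :: "astruct set" where
  conjI: "\<lbrakk> struct_for D A; struct_for E B \<rbrakk> \<Longrightarrow> Node (Conj A B) None [D, E] \<in> intro_rules"
| disjI1: "struct_for D A \<Longrightarrow> Node (Disj A B) None [D] \<in> intro_rules"
| disjI2: "struct_for D B \<Longrightarrow> Node (Disj A B) None [D] \<in> intro_rules"
| impI: "\<lbrakk> arg_struct (Node (Impl A B) None [t]); concl t = B; dis_by 0 t \<subseteq> {A} \<rbrakk>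
    \<Longrightarrow> Node (Impl A B) None [t] \<in> intro_rules"

inductive_set elim_rules :: "astruct set" where
  conjE1: "struct_for D (Conj A B) \<Longrightarrow> Node A None [D] \<in> elim_rules"
| conjE2: "struct_for D (Conj A B) \<Longrightarrow> Node B None [D] \<in> elim_rules"
| disjE: "\<lbrakk> arg_struct (Node C None [D, t, u]); struct_for D (Disj A B);
      concl t = C; dis_by 0 t \<subseteq> {A}; concl u = C; dis_by 0 u \<subseteq> {B} \<rbrakk>
    \<Longrightarrow> Node C None [D, t, u] \<in> elim_rules"
| impE: "\<lbrakk> struct_for D (Impl A B); struct_for E A \<rbrakk> \<Longrightarrow> Node B None [D, E] \<in> elim_rules"
| botE: "struct_for D (Atom Bot) \<Longrightarrow> Node A None [D] \<in> elim_rules"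

abbreviation canonical :: "astruct \<Rightarrow> bool" where
  "canonical D \<equiv> D \<in> intro_rules"


section \<open>Derivability in intuitionistic propositional logic\<close>

text \<open>
  Natural deduction derivations in the extension of intuitionistic logic by \<open>R\<close>.
\<close>

inductive derivation :: "astruct set \<Rightarrow> astruct \<Rightarrow> bool" for R :: "astruct set" where
  "derivation R (Assm A None)"
| "\<lbrakk> D \<in> intro_rules \<union> elim_rules \<union> R; \<forall>P\<in>set (immediate_subs D). derivation R P \<rbrakk>
    \<Longrightarrow> derivation R D"

definition IL_ext_derives :: "astruct set \<Rightarrow> formula set \<Rightarrow> formula \<Rightarrow> bool" where
  "IL_ext_derives R \<Gamma> A \<longleftrightarrow> (\<exists>D. derivation R D \<and> assms_of D \<subseteq> \<Gamma> \<and> concl D = A)"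

definition IL_derives :: "formula set \<Rightarrow> formula \<Rightarrow> bool"  (infix "\<turnstile>\<^sub>I\<^sub>L" 50) where
  "\<Gamma> \<turnstile>\<^sub>I\<^sub>L A \<longleftrightarrow> IL_ext_derives {} \<Gamma> A"

definition derivable_in_IL :: "astruct set \<Rightarrow> bool" where
  "derivable_in_IL R \<longleftrightarrow> (\<forall>\<Gamma> A. IL_ext_derives R \<Gamma> A \<longrightarrow> \<Gamma> \<turnstile>\<^sub>I\<^sub>L A)"


section \<open>Computable partial functions on argument structures\<close>

text \<open>
  Kleene's partial recursive functions. \<open>reval f xs y\<close> means that \<open>f\<close> is defined on \<open>xs\<close> with value \<open>y\<close>.
\<close>

datatype recf = Zero | Succ | Proj nat | Comp recf "recf list" | PrimRec recf recf | Mu recf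

inductive reval :: "recf \<Rightarrow> nat list \<Rightarrow> nat \<Rightarrow> bool" where
  "reval Zero xs 0"
| "reval Succ (x # xs) (Suc x)"
| "i < length xs \<Longrightarrow> reval (Proj i) xs (xs ! i)"
| "\<lbrakk> list_all2 (\<lambda>g y. reval g xs y) gs ys; reval f ys z \<rbrakk> \<Longrightarrow> reval (Comp f gs) xs z"
| "reval f xs y \<Longrightarrow> reval (PrimRec f g) (0 # xs) y"
| "\<lbrakk> reval (PrimRec f g) (n # xs) r; reval g (n # r # xs) y \<rbrakk>
    \<Longrightarrow> reval (PrimRec f g) (Suc n # xs) y"
| "\<lbrakk> reval f (n # xs) 0; \<forall>m<n. \<exists>y. reval f (m # xs) (Suc y) \<rbrakk> \<Longrightarrow> reval (Mu f) xs n"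

fun atom_code :: "atom \<Rightarrow> nat" where
  "atom_code Bot = 0"
| "atom_code (Var i) = Suc i"

fun formula_code :: "formula \<Rightarrow> nat" where
  "formula_code (Atom a) = prod_encode (0, atom_code a)"
| "formula_code (Conj A B) = prod_encode (1, prod_encode (formula_code A, formula_code B))"
| "formula_code (Disj A B) = prod_encode (2, prod_encode (formula_code A, formula_code B))"
| "formula_code (Impl A B) = prod_encode (3, prod_encode (formula_code A, formula_code B))"

fun discharge_code :: "nat option \<Rightarrow> nat" where
  "discharge_code None = 0"
| "discharge_code (Some k) = Suc k"

fun struct_code :: "astruct \<Rightarrow> nat" where
  "struct_code (Assm A d) =
     prod_encode (0, prod_encode (formula_code A, discharge_code d))"
| "struct_code (Node A d ts) =
     prod_encode (1, prod_encode (formula_code A,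
       prod_encode (discharge_code d, list_encode (map struct_code ts))))"

definition computable :: "(astruct \<rightharpoonup> astruct) \<Rightarrow> bool" where
  "computable \<phi> \<longleftrightarrow> (\<exists>f. \<forall>x y. reval f [x] y \<longleftrightarrow>
     (\<exists>D E. \<phi> D = Some E \<and> x = struct_code D \<and> y = struct_code E))"


section \<open>Reductions\<close>

definition reduction_for :: "astruct set \<Rightarrow> (astruct \<rightharpoonup> astruct) \<Rightarrow> bool" where
  "reduction_for R \<phi> \<longleftrightarrow>
     computable \<phi> \<and> dom \<phi> \<subseteq> R \<and>
     (\<forall>D E. \<phi> D = Some E \<longrightarrow>
        arg_struct E \<and> assms_of E \<subseteq> assms_of D \<and> concl E = concl D \<and>
        (\<forall>\<sigma>. (\<forall>A\<in>assms_of D. struct_for (\<sigma> A) A) \<longrightarrow>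
           \<phi> (subst \<sigma> D) = Some (subst \<sigma> E)))"

lemma computable_empty: "computable (\<lambda>_. None)"
proof -
  have "\<not> reval (Mu (Comp Succ [Zero])) [x] y" for x y
  proof
    assume "reval (Mu (Comp Succ [Zero])) [x] y"
    then have "reval (Comp Succ [Zero]) (y # [x]) 0"
      by (cases rule: reval.cases) auto
    then obtain ys where "reval Succ ys 0"
      by (cases rule: reval.cases) auto
    then show False
      by (cases rule: reval.cases)
  qed
  then show ?thesis
    unfolding computable_def by auto
qed

typedef reduction = "{\<phi>. \<exists>R. inference_rule R \<and> reduction_for R \<phi>}"
  by (rule exI[of _ "\<lambda>_. None"])
    (auto simp: reduction_for_def inference_rule_def computable_empty)

text \<open>
  Replacing a sub-structure by its reduct requires readjusting the discharges that relate it to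
  the nodes below it. \<open>free_occs 0 t\<close> collects the assumptions and the rule applications of \<open>t\<close> that
  are not discharged within \<open>t\<close>, each with its discharge in the surrounding structure (\<open>None\<close>, or
  \<open>Some k\<close> for the \<open>k\<close>-th node below the root of \<open>t\<close>). A rule application is described by
  its conclusion, its premises, and whether it discharges assumptions.
\<close>

datatype occ = AssmOcc formula | RuleOcc formula "formula list" bool

definition free_at :: "nat \<Rightarrow> occ \<Rightarrow> nat option \<Rightarrow> (occ \<times> nat option) set" where
  "free_at n x d =
     (if \<forall>k. d = Some k \<longrightarrow> n \<le> k then {(x, map_option (\<lambda>k. k - n) d)} else {})"

fun free_occs :: "nat \<Rightarrow> astruct \<Rightarrow> (occ \<times> nat option) set" where
  "free_occs n (Assm A d) = free_at n (AssmOcc A) d"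
| "free_occs n (Node A d ts) =
     free_at n (RuleOcc A (map concl ts) (\<exists>t\<in>set ts. dis_by 0 t \<noteq> {})) d \<union>
     (\<Union>t\<in>set ts. free_occs (Suc n) t)"

text \<open>
  Every free assumption or rule application of the new subtree \<open>t'\<close> is discharged like some free
  occurrence of the same assumption or rule application in the old subtree \<open>t\<close>; rule
  applications without such an occurrence in \<open>t\<close> remain undischarged.
\<close>

definition readjusted :: "astruct \<Rightarrow> astruct \<Rightarrow> bool" where
  "readjusted t t' \<longleftrightarrow>
     (\<forall>(x, d)\<in>free_occs 0 t'. (x, d) \<in> free_occs 0 t \<or> (x \<notin> fst ` free_occs 0 t \<and> d = None))"

inductive reduces1 :: "reduction set \<Rightarrow> astruct \<Rightarrow> astruct \<Rightarrow> bool" for J :: "reduction set" where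
  here: "\<lbrakk> \<phi> \<in> J; Rep_reduction \<phi> (prune 0 t) = Some (prune 0 t'); readjusted t t' \<rbrakk>
    \<Longrightarrow> reduces1 J t t'"
| there: "reduces1 J t t' \<Longrightarrow> reduces1 J (Node A d (ts @ t # us)) (Node A d (ts @ t' # us))"

abbreviation reduces :: "reduction set \<Rightarrow> astruct \<Rightarrow> astruct \<Rightarrow> bool" where
  "reduces J \<equiv> (reduces1 J)\<^sup>*\<^sup>*"


section \<open>Validity\<close>

lemma concl_prune [simp]: "concl (prune n t) = concl t"
  by (cases t) auto

lemma concl_subst: "(\<forall>A\<in>assms_of t. concl (\<sigma> A) = A) \<Longrightarrow> concl (subst \<sigma> t) = concl t"
  by (cases t) auto

lemma finite_assms_of: "finite (assms_of t)"
  by (induction t) auto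

lemma assms_of_subst_closed:
  "(\<forall>A\<in>assms_of t. assms_of (\<sigma> A) = {}) \<Longrightarrow> assms_of (subst \<sigma> t) = {}"
  by (induction t) auto

lemma assms_of_free_occs: "A \<in> assms_of t \<longleftrightarrow> (AssmOcc A, None) \<in> free_occs n t"
  by (induction t arbitrary: n) (auto simp: free_at_def)

lemma assms_of_prune: "A \<in> assms_of (prune n t) \<longleftrightarrow> AssmOcc A \<in> fst ` free_occs n t"
proof (induction t arbitrary: n)
  case (Assm B d)
  then show ?case by (cases d) (auto simp: free_at_def)
next
  case (Node B d ts)
  have "AssmOcc A \<notin> fst ` free_at n (RuleOcc B bs c) d" for bs c
    by (auto simp: free_at_def)
  then show ?case
    using Node by (simp add: image_Un image_UN)
qed

lemma Rep_reductionD: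
  assumes "Rep_reduction \<phi> D = Some E"
  shows "assms_of E \<subseteq> assms_of D" "concl E = concl D"
  using Rep_reduction[of \<phi>] assms unfolding reduction_for_def by blast+

lemma reduces1_preserves:
  assumes "reduces1 J t t'"
  shows "concl t' = concl t \<and> assms_of t' \<subseteq> assms_of t"
  using assms
proof induction
  case (here \<phi> t t')
  note D = Rep_reductionD[OF here(2)]
  have "A \<in> assms_of t" if "A \<in> assms_of t'" for A
  proof -
    have "(AssmOcc A, None) \<in> free_occs 0 t'"
      using that assms_of_free_occs by blast
    moreover from this have "AssmOcc A \<in> fst ` free_occs 0 t"
      using D(1) assms_of_prune[of A 0 t] assms_of_prune[of A 0 t'] by force
    ultimately have "(AssmOcc A, None) \<in> free_occs 0 t"
      using here(3) by (auto simp: readjusted_def)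
    then show ?thesis
      using assms_of_free_occs by blast
  qed
  then show ?case
    using D(2) by auto
qed auto

lemma reduces_preserves:
  assumes "reduces J t t'"
  shows "concl t' = concl t \<and> assms_of t' \<subseteq> assms_of t"
  using assms by induction (use reduces1_preserves in force)+

lemma assms_of_prune_dis_by:
  "wf_struct env t \<Longrightarrow> length env = Suc n \<Longrightarrow> assms_of (prune n t) \<subseteq> assms_of t \<union> dis_by n t"
proof (induction t arbitrary: n env)
  case (Assm A d)
  then show ?case by (cases d) auto
next
  case (Node A d ts)
  have "assms_of (prune (Suc n) t) \<subseteq> assms_of t \<union> dis_by (Suc n) t" if "t \<in> set ts" for t
    using that Node.prems
    by (intro Node.IH[of t "atomic_node (Node A d ts) # env"]) auto
  then show ?case by fastforce
qed

lemma prune_wf: "wf_struct env t \<Longrightarrow> length env \<le> n \<Longrightarrow> prune n t = t"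
proof (induction t arbitrary: n env)
  case (Assm A d)
  then show ?case by (cases d) auto
next
  case (Node A d ts)
  have "prune (Suc n) t = t" if "t \<in> set ts" for t
    using that Node.prems
    by (intro Node.IH[of t "atomic_node (Node A d ts) # env"]) auto
  then show ?case
    using Node.prems by (cases d) (auto intro: map_idI)
qed

definition rank :: "astruct \<Rightarrow> nat" where
  "rank D = Max (size ` insert (concl D) (assms_of D))"

lemma rank_le: "(\<forall>A\<in>insert (concl D) (assms_of D). size A \<le> m) \<Longrightarrow> rank D \<le> m"
  unfolding rank_def by (subst Max_le_iff) (auto simp: finite_assms_of)

lemma size_le_rank: "A \<in> insert (concl D) (assms_of D) \<Longrightarrow> size A \<le> rank D"
  unfolding rank_def by (intro Max_ge) (auto simp: finite_assms_of)

lemma rank_closed: "assms_of D = {} \<Longrightarrow> rank D = size (concl D)"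
  by (simp add: rank_def)

lemma rank_canonical_premise:
  assumes "canonical D" "closed_struct D" "P \<in> set (immediate_subs D)"
  shows "rank P < rank D"
  using assms(1)
proof cases
  case (conjI E A F B)
  then have "prune 0 E = E" "prune 0 F = F"
    by (auto simp: struct_for_def arg_struct_def intro: prune_wf)
  then show ?thesis
    using conjI assms by (auto simp: rank_def struct_for_def)
next
  case (disjI1 E A B)
  then have "prune 0 E = E"
    by (auto simp: struct_for_def arg_struct_def intro: prune_wf)
  then show ?thesis
    using disjI1 assms by (auto simp: rank_def struct_for_def)
next
  case (disjI2 E B A)
  then have "prune 0 E = E"
    by (auto simp: struct_for_def arg_struct_def intro: prune_wf)
  then show ?thesis
    using disjI2 assms by (auto simp: rank_def struct_for_def)
next
  case (impI A B t)
  have "assms_of (prune 0 t) \<subseteq> assms_of t \<union> dis_by 0 t"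
    using impI(2) by (intro assms_of_prune_dis_by) (auto simp: arg_struct_def)
  then have "assms_of (prune 0 t) \<subseteq> {A}"
    using impI assms(2) by auto
  then have "rank (prune 0 t) \<le> max (size A) (size B)"
    using impI by (intro rank_le) auto
  then show ?thesis
    using impI assms by (auto simp: rank_closed)
qed

context
  notes conj_cong [fundef_cong]
begin

text \<open>
  The recursion is well-founded by the maximal size of the formulas among the conclusion and the
  undischarged assumptions, closed structures preceding open ones.
\<close>

function valid :: "reduction set \<Rightarrow> arule set \<Rightarrow> astruct \<Rightarrow> bool" where
  "valid J \<BB> D \<longleftrightarrow>
    (if closed_struct D then
       (if is_atomic (concl D)
        then \<exists>E. reduces J D E \<and> E \<in> DER \<BB> \<and> concl E = concl D
        else \<exists>E. (reduces J D E \<and> canonical E) \<and> (\<forall>P\<in>set (immediate_subs E). valid J \<BB> P))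
     else
       (\<forall>\<sigma> H \<CC>.
          (\<forall>A\<in>assms_of D. struct_for (\<sigma> A) A \<and> closed_struct (\<sigma> A)) \<longrightarrow>
          J \<subseteq> H \<longrightarrow> \<BB> \<subseteq> \<CC> \<longrightarrow> atomic_base \<CC> \<longrightarrow>
          (\<forall>A\<in>assms_of D. valid H \<CC> (\<sigma> A)) \<longrightarrow>
          valid H \<CC> (subst \<sigma> D)))"
  by auto

termination
proof (relation "measures [\<lambda>(J, \<BB>, D). rank D, \<lambda>(J, \<BB>, D). if closed_struct D then 0 else 1]",
    goal_cases)
  case 1
  show ?case by simp
next
  case (2 J \<BB> D E P)
  then have "concl E = concl D" "assms_of E = {}"
    using reduces_preserves[of J D E] by auto
  then show ?case
    using 2 rank_canonical_premise[of E P] by (simp add: rank_closed)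
next
  case (3 J \<BB> D \<sigma> H \<CC> A)
  then show ?case
    using size_le_rank[of A D] by (auto simp: rank_closed struct_for_def)
next
  case (4 J \<BB> D \<sigma> H \<CC>)
  then have "concl (subst \<sigma> D) = concl D" "assms_of (subst \<sigma> D) = {}"
    by (auto simp: struct_for_def intro!: concl_subst assms_of_subst_closed)
  then show ?case
    using 4 size_le_rank[of "concl D" D] by (auto simp: rank_closed)
qed

end

declare valid.simps [simp del]

definition logically_valid :: "reduction set \<Rightarrow> astruct \<Rightarrow> bool" where
  "logically_valid J D \<longleftrightarrow> (\<forall>\<BB>. atomic_base \<BB> \<longrightarrow> valid J \<BB> D)"

definition consequence :: "formula set \<Rightarrow> formula \<Rightarrow> bool"  (infix "\<TTurnstile>" 50) where
  "\<Gamma> \<TTurnstile> A \<longleftrightarrow> (\<exists>D J. struct_for D A \<and> assms_of D = \<Gamma> \<and> logically_valid J D)"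

definition rule_valid :: "astruct set \<Rightarrow> reduction set \<Rightarrow> arule set \<Rightarrow> bool" where
  "rule_valid R J \<BB> \<longleftrightarrow>
     (\<forall>H \<CC>. J \<subseteq> H \<longrightarrow> \<BB> \<subseteq> \<CC> \<longrightarrow> atomic_base \<CC> \<longrightarrow>
        (\<forall>D\<in>R. (\<forall>P\<in>set (immediate_subs D). valid H \<CC> P) \<longrightarrow> valid H \<CC> D))"

definition rule_logically_valid :: "astruct set \<Rightarrow> reduction set \<Rightarrow> bool" where
  "rule_logically_valid R J \<longleftrightarrow> (\<forall>\<BB>. atomic_base \<BB> \<longrightarrow> rule_valid R J \<BB>)"

end

theory Submission
  imports Defs
begin

text \<open>
  The counterexample is the inference from \<open>p \<rightarrow> q \<or> r\<close> to \<open>(p \<rightarrow> q) \<or> (p \<rightarrow> r)\<close> for distinct atoms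
  \<open>p\<close>, \<open>q\<close>, \<open>r\<close>, which a three-world Kripke model refutes in intuitionistic logic.

  Take all reductions for \<open>\<JJ>\<close>. A function defined at a single closed structure \<open>D\<close>, with any closed
  structure for the same formula as its value, is computable and trivially commutes with
  substitution, so it is a reduction. Hence \<open>D\<close> is valid as soon as some closed structure with the
  same conclusion is, and validity of \<open>A\<close> becomes a forcing relation between bases and formulas.
  If a base forces \<open>p \<rightarrow> q \<or> r\<close>, its extension by the axiom \<open>p\<close> derives \<open>q\<close> or derives \<open>r\<close>; say \<open>q\<close>.
  By cutting the axiom \<open>p\<close> against derivations of \<open>p\<close>, every extension of the original base that
  derives \<open>p\<close> derives \<open>q\<close>, so the original base forces \<open>p \<rightarrow> q\<close>.
\<close>

section \<open>Substitution in argument structures\<close>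

text \<open>Discharge indices count from the nearest ancestor, so adding ancestors beyond the
  outermost one disturbs none of them.\<close>

lemma wf_struct_append: "wf_struct env t \<Longrightarrow> wf_struct (env @ env') t"
  by (induction t arbitrary: env) (fastforce simp: nth_append)+

lemma wf_struct_dis_by: "wf_struct env t \<Longrightarrow> length env \<le> n \<Longrightarrow> dis_by n t = {}"
proof (induction t arbitrary: env n)
  case (Node A d ts)
  then show ?case
    using Node.IH[of _ "atomic_node (Node A d ts) # env" "Suc n"] by auto
qed auto

text \<open>Every discharge target is one of the \<open>length env\<close> ancestors, so no
  discharge reaches beyond depth \<open>n\<close>. With empty \<open>env\<close> this makes
  \<open>readjusted\<close> easy to check.\<close>

lemma wf_struct_free_occs:
  "wf_struct env t \<Longrightarrow> length env \<le> n \<Longrightarrow> (x, d) \<in> free_occs n t \<Longrightarrow> d = None"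
proof (induction t arbitrary: env n)
  case (Assm A e)
  then show ?case by (cases e) (auto simp: free_at_def split: if_splits)
next
  case (Node A e ts)
  show ?case
  proof (cases "\<exists>t\<in>set ts. (x, d) \<in> free_occs (Suc n) t")
    case True
    then show ?thesis
      using Node.prems Node.IH[of _ "atomic_node (Node A e ts) # env" "Suc n"] by auto
  next
    case False
    then show ?thesis
      using Node.prems by (cases e) (auto simp: free_at_def split: if_splits)
  qed
qed

lemma arg_struct_prune [simp]: "arg_struct D \<Longrightarrow> prune 0 D = D"
  by (auto simp: arg_struct_def intro: prune_wf)

lemma arg_struct_Node:
  assumes "\<forall>t\<in>set ts. arg_struct t"
  shows "arg_struct (Node A None ts)"
  using assms wf_struct_append[of "[]"] by (fastforce simp: arg_struct_def)

lemma dis_by_subst: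
  assumes "\<forall>A\<in>assms_of t. arg_struct (\<sigma> A)"
  shows "dis_by n (subst \<sigma> t) = dis_by n t"
  using assms by (induction t arbitrary: n) (auto simp: arg_struct_def wf_struct_dis_by)

lemma atomic_node_subst:
  assumes "\<forall>A\<in>assms_of (Node B d ts). struct_for (\<sigma> A) A"
  shows "atomic_node (subst \<sigma> (Node B d ts)) = atomic_node (Node B d ts)"
proof -
  have "concl (subst \<sigma> t) = concl t" "dis_by 0 (subst \<sigma> t) = dis_by 0 t" if "t \<in> set ts" for t
    using assms that by (auto simp: struct_for_def intro!: concl_subst dis_by_subst)
  then show ?thesis by simp
qed

lemma wf_struct_subst:
  assumes "wf_struct env t" "\<forall>A\<in>assms_of t. struct_for (\<sigma> A) A"
  shows "wf_struct env (subst \<sigma> t)"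
  using assms
proof (induction t arbitrary: env)
  case (Assm A d)
  then show ?case
    using wf_struct_append[of "[]"] by (auto simp: struct_for_def arg_struct_def)
next
  case (Node B d ts)
  have "atomic_node (Node B e (map (subst \<sigma>) ts)) = atomic_node (Node B e ts)" for e
    using atomic_node_subst[of B e ts \<sigma>] Node.prems(2) by simp
  moreover have "wf_struct (atomic_node (Node B d ts) # env) (subst \<sigma> t)" if "t \<in> set ts" for t
    using Node.prems that by (intro Node.IH) auto
  ultimately show ?case
    using Node.prems(1) by (simp del: atomic_node.simps)
qed

lemma struct_for_subst:
  assumes "struct_for D B" "\<forall>A\<in>assms_of D. struct_for (\<sigma> A) A"
  shows "struct_for (subst \<sigma> D) B"
  using assms wf_struct_subst[of "[]"] concl_subst[of D \<sigma>] by (simp add: struct_for_def arg_struct_def)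

lemma subst_closed: "closed_struct D \<Longrightarrow> subst \<sigma> D = D"
  by (induction D) (auto intro: map_idI split: if_splits)

lemma closed_structE:
  assumes "arg_struct D" "closed_struct D"
  obtains A ts where "D = Node A None ts"
  using assms by (cases D) (auto simp: arg_struct_def split: if_splits option.splits)


section \<open>Reductions defined at a single closed structure\<close>

fun const_recf :: "nat \<Rightarrow> recf" where
  "const_recf 0 = Zero"
| "const_recf (Suc n) = Comp Succ [const_recf n]"

inductive_simps reval_Zero [simp]: "reval Zero xs y"
inductive_simps reval_Succ [simp]: "reval Succ xs y"
inductive_simps reval_Proj [simp]: "reval (Proj i) xs y"
inductive_simps reval_Comp [simp]: "reval (Comp f gs) xs y"
inductive_simps reval_PrimRec_0 [simp]: "reval (PrimRec f g) (0 # xs) y"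
inductive_simps reval_PrimRec_Suc [simp]: "reval (PrimRec f g) (Suc n # xs) y"
inductive_simps reval_Mu: "reval (Mu f) xs y"

lemma reval_const [simp]: "reval (const_recf n) xs y \<longleftrightarrow> y = n"
  by (induction n arbitrary: y) (auto simp: list_all2_Cons1)

text \<open>The recursion lowers both numbers together: in the successor step \<open>Proj 0\<close>
  is the predecessor of the argument.\<close>

fun neq_recf :: "nat \<Rightarrow> recf" where
  "neq_recf 0 = PrimRec Zero (const_recf 1)"
| "neq_recf (Suc c) = PrimRec (const_recf 1) (Comp (neq_recf c) [Proj 0])"

lemma reval_neq [simp]: "reval (neq_recf c) [n] y \<longleftrightarrow> y = (if n = c then 0 else 1)"
proof (induction c arbitrary: n y)
  case 0
  show ?case
    by (induction n arbitrary: y) (simp_all del: const_recf.simps)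
next
  case (Suc c)
  show ?case
    by (induction n arbitrary: y) (simp_all add: Suc list_all2_Cons1 del: const_recf.simps)
qed

lemma computable_single: "computable [D \<mapsto> E]"
proof -
  \<comment> \<open>\<open>Mu\<close> passes the trial value first and the input second, hence
    \<open>Proj 1\<close>. The search stops at 0 if the input codes \<open>D\<close> and otherwise
    never ends, which leaves the function undefined there.\<close>
  let ?h = "Comp (neq_recf (struct_code D)) [Proj 1]"
  let ?f = "Comp (const_recf (struct_code E)) [Mu ?h]"
  have h: "reval ?h [n, x] y \<longleftrightarrow> y = (if x = struct_code D then 0 else 1)" for n x y
    by (simp add: list_all2_Cons1)
  have "reval (Mu ?h) [x] n \<longleftrightarrow> x = struct_code D \<and> n = 0" for x n
    unfolding reval_Mu h by (auto split: if_splits)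
  then have "reval ?f [x] y \<longleftrightarrow> x = struct_code D \<and> y = struct_code E" for x y
    by (auto simp: list_all2_Cons1)
  then show ?thesis
    unfolding computable_def by (intro exI[of _ ?f]) (auto split: if_splits)
qed

lemma reduces_closed:
  assumes "struct_for D A" "closed_struct D" "struct_for E A" "closed_struct E"
  shows "reduces UNIV D E"
proof -
  have DE: "arg_struct D" "arg_struct E" "concl E = concl D"
    using assms by (auto simp: struct_for_def)
  have "inference_rule {D}"
    using DE(1) assms(2) by (auto simp: inference_rule_def elim: closed_structE)
  moreover have "reduction_for {D} [D \<mapsto> E]"
    using DE assms by (auto simp: reduction_for_def computable_single subst_closed split: if_splits)
  ultimately have "Rep_reduction (Abs_reduction [D \<mapsto> E]) = [D \<mapsto> E]"
    by (intro Abs_reduction_inverse) blast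
  \<comment> \<open>All free occurrences on both sides carry \<open>None\<close>, so one occurring
    in both structures has the same discharge in both.\<close>
  moreover have "readjusted D E"
  proof -
    have "d = None" if "(x, d) \<in> free_occs 0 D \<union> free_occs 0 E" for x d
      using that DE wf_struct_free_occs[of "[]" _ 0] by (auto simp: arg_struct_def)
    then show ?thesis
      unfolding readjusted_def by (clarsimp simp: image_iff) (metis option.distinct(1) prod.collapse)
  qed
  ultimately have "reduces1 UNIV D E"
    using DE by (intro reduces1.here[of "Abs_reduction [D \<mapsto> E]"]) auto
  then show ?thesis ..
qed


section \<open>Validity relative to all reductions\<close>

lemma valid_closed_atomic:
  "closed_struct D \<Longrightarrow> concl D = Atom a \<Longrightarrow>
    valid J \<BB> D \<longleftrightarrow> (\<exists>E. reduces J D E \<and> E \<in> DER \<BB> \<and> concl E = Atom a)"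
  by (subst valid.simps) simp

lemma valid_closed_nonatomic:
  "closed_struct D \<Longrightarrow> \<not> is_atomic (concl D) \<Longrightarrow>
    valid J \<BB> D \<longleftrightarrow>
      (\<exists>E. reduces J D E \<and> canonical E \<and> (\<forall>P\<in>set (immediate_subs E). valid J \<BB> P))"
  by (subst valid.simps) simp

text \<open>\<open>UNIV\<close> has no proper superset, so the quantifier over larger sets of
  reductions disappears.\<close>

lemma valid_UNIV_open:
  assumes "\<not> closed_struct D"
  shows "valid UNIV \<BB> D \<longleftrightarrow>
    (\<forall>\<sigma> \<CC>. (\<forall>A\<in>assms_of D. struct_for (\<sigma> A) A \<and> closed_struct (\<sigma> A) \<and> valid UNIV \<CC> (\<sigma> A)) \<longrightarrow>
      \<BB> \<subseteq> \<CC> \<longrightarrow> atomic_base \<CC> \<longrightarrow> valid UNIV \<CC> (subst \<sigma> D))"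
  using assms by (subst valid.simps) (auto simp: top.extremum_unique)

lemma valid_UNIV_subst:
  assumes "valid UNIV \<BB> D" "\<not> closed_struct D" "\<BB> \<subseteq> \<CC>" "atomic_base \<CC>"
    and "\<And>A. A \<in> assms_of D \<Longrightarrow> struct_for (\<sigma> A) A \<and> closed_struct (\<sigma> A) \<and> valid UNIV \<CC> (\<sigma> A)"
  shows "valid UNIV \<CC> (subst \<sigma> D)"
  using assms valid_UNIV_open by blast

lemma valid_UNIV_openI:
  assumes "\<not> closed_struct D"
    and "\<And>\<sigma> \<CC>. \<lbrakk> \<forall>A\<in>assms_of D. struct_for (\<sigma> A) A \<and> closed_struct (\<sigma> A) \<and> valid UNIV \<CC> (\<sigma> A);
      \<BB> \<subseteq> \<CC>; atomic_base \<CC> \<rbrakk> \<Longrightarrow> valid UNIV \<CC> (subst \<sigma> D)"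
  shows "valid UNIV \<BB> D"
  using assms valid_UNIV_open by blast

text \<open>Validity of a closed structure only asks what it reduces to, and reduction is
  transitive.\<close>

lemma valid_if_reduces:
  assumes "reduces J D E" "closed_struct D" "valid J \<BB> E"
  shows "valid J \<BB> D"
proof -
  have E: "concl E = concl D" "closed_struct E"
    using reduces_preserves[OF assms(1)] assms(2) by auto
  show ?thesis
  proof (cases "concl D")
    case (Atom a)
    then show ?thesis
      using assms E by (auto simp: valid_closed_atomic intro: rtranclp_trans)
  qed (use assms E in \<open>auto simp: valid_closed_nonatomic intro: rtranclp_trans\<close>)
qed

text \<open>Closed structures for the same formula reduce to each other, so their validity depends
  only on the formula and the base.\<close>

lemma valid_UNIV_closed:
  assumes "struct_for D A" "closed_struct D" "struct_for E A" "closed_struct E" "valid UNIV \<BB> E"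
  shows "valid UNIV \<BB> D"
  using assms reduces_closed valid_if_reduces by blast

section \<open>Atomic derivations and derivability of atoms in a base\<close>

text \<open>All labels are atoms and no assumption occurs, so every node satisfies
  \<open>atomic_node\<close>; hence the all-\<open>True\<close> environment.\<close>

lemma atomic_deriv_struct:
  assumes "atomic_deriv \<BB> env D"
  shows "wf_struct (replicate (length env) True) D \<and> assms_of D = {} \<and> (\<forall>n. dis_by n D = {})"
  using assms
proof induction
  case (1 env qs ts d a)
  have sub: "\<exists>b. concl t = Atom b" "wf_struct (True # replicate (length env) True) t"
    "assms_of t = {}" "dis_by n t = {}" if "t \<in> set ts" for t n
    using 1(1) that by (auto simp: list_all2_conv_all_nth in_set_conv_nth)
  then have "is_atomic (concl t)" if "t \<in> set ts" for t
    using that by fastforce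
  then have "atomic_node (Node (Atom a) d ts)"
    using sub by simp
  then show ?case
    using 1(2) sub by auto
qed

lemma DER_struct:
  assumes "E \<in> DER \<BB>"
  shows "arg_struct E" "closed_struct E"
  using atomic_deriv_struct[of \<BB> "[]" E] assms by (auto simp: DER_def arg_struct_def)

definition derives :: "arule set \<Rightarrow> atom \<Rightarrow> bool" where
  "derives \<BB> a \<longleftrightarrow> (\<exists>E\<in>DER \<BB>. concl E = Atom a)"

lemma valid_UNIV_atomic:
  assumes "struct_for D (Atom a)" "closed_struct D"
  shows "valid UNIV \<BB> D \<longleftrightarrow> derives \<BB> a"
proof -
  have "reduces UNIV D E" if "E \<in> DER \<BB>" "concl E = Atom a" for E
    using reduces_closed[OF assms] DER_struct[OF that(1)] that(2) by (simp add: struct_for_def)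
  then show ?thesis
    using assms by (auto simp: valid_closed_atomic derives_def struct_for_def)
qed

lemma atomic_deriv_append: "atomic_deriv \<BB> env D \<Longrightarrow> atomic_deriv \<BB> (env @ env') D"
proof (induction rule: atomic_deriv.induct)
  case (1 env qs ts d a)
  then show ?case
    by (intro atomic_deriv.intros)
      (auto simp: nth_append elim!: list.rel_mono_strong split: option.splits)
qed

text \<open>Each undischarged use of the axiom \<open>a\<close> is replaced by a derivation of
  \<open>a\<close> in \<CC>; discharged uses are licensed by \<open>env\<close> and stay.\<close>

lemma atomic_deriv_cut:
  assumes "atomic_deriv (insert (ARule [] a) \<BB>) env D" "\<BB> \<subseteq> \<CC>" "derives \<CC> a"
  shows "\<exists>D'. atomic_deriv \<CC> env D' \<and> concl D' = concl D"
  using assms(1)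
proof induction
  case (1 env qs ts d b)
  show ?case
  proof (cases "d = None \<and> ARule qs b = ARule [] a")
    case True
    then show ?thesis
      using assms(3) atomic_deriv_append[of \<CC> "[]"] by (fastforce simp: derives_def DER_def)
  next
    case False
    have "\<forall>i<length ts. \<exists>t'. concl t' = Atom (snd (qs ! i)) \<and>
        atomic_deriv \<CC> (fst (qs ! i) # env) t'"
      using 1(1) unfolding list_all2_conv_all_nth by fastforce
    then obtain f where f: "\<forall>i<length ts. concl (f i) = Atom (snd (qs ! i)) \<and>
        atomic_deriv \<CC> (fst (qs ! i) # env) (f i)"
      by metis
    have "atomic_deriv \<CC> env (Node (Atom b) d (map f [0..<length ts]))"
      using 1 False f assms(2)
      by (intro atomic_deriv.intros[where qs = qs])
        (auto simp: list_all2_conv_all_nth split: option.splits)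
    then show ?thesis by fastforce
  qed
qed

lemma derives_cut:
  "derives (insert (ARule [] a) \<BB>) b \<Longrightarrow> \<BB> \<subseteq> \<CC> \<Longrightarrow> derives \<CC> a \<Longrightarrow> derives \<CC> b"
  using atomic_deriv_cut[of a \<BB> "[]" _ \<CC>] unfolding derives_def[of _ b] DER_def
  by (metis mem_Collect_eq)

lemma derives_axiom: "derives (insert (ARule [] a) \<BB>) a"
  unfolding derives_def DER_def
  by (rule bexI[of _ "Node (Atom a) None []"]) (auto intro!: atomic_deriv.intros[where qs = "[]"])

lemma derives_mono:
  assumes "derives \<BB> a" "\<BB> \<subseteq> \<CC>"
  shows "derives \<CC> a"
proof -
  have "atomic_deriv \<CC> env D" if "atomic_deriv \<BB> env D" for env D
    using that
  proof induction
    case (1 env qs ts d b)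
    then show ?case
      using assms(2)
      by (intro atomic_deriv.intros[where qs = qs])
        (auto elim!: list.rel_mono_strong split: option.splits)
  qed
  then show ?thesis
    using assms(1) by (auto simp: derives_def DER_def)
qed

lemma atomic_base_insert: "atomic_base \<BB> \<Longrightarrow> atomic_base (insert \<rr> \<BB>)"
  unfolding atomic_base_def by (metis Un_insert_left finite.insertI)

section \<open>Valid disjunctions and implications between atoms\<close>

lemma canonical_DisjE:
  assumes "canonical D" "concl D = Disj A B"
  obtains E where "D = Node (Disj A B) None [E]" "struct_for E A \<or> struct_for E B"
  using assms by (cases rule: intro_rules.cases) auto

lemma canonical_ImplE:
  assumes "canonical D" "concl D = Impl A B"
  obtains t where "D = Node (Impl A B) None [t]" "arg_struct D" "concl t = B" "dis_by 0 t \<subseteq> {A}"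
  using assms by (cases rule: intro_rules.cases) auto

lemma valid_Disj_derives:
  assumes "closed_struct D" "concl D = Disj (Atom a) (Atom b)" "valid UNIV \<BB> D"
  shows "derives \<BB> a \<or> derives \<BB> b"
proof -
  obtain E where E: "reduces UNIV D E" "canonical E" "\<forall>P\<in>set (immediate_subs E). valid UNIV \<BB> P"
    using assms by (auto simp: valid_closed_nonatomic)
  have E': "concl E = Disj (Atom a) (Atom b)" "closed_struct E"
    using reduces_preserves[OF E(1)] assms by auto
  obtain F where F: "E = Node (Disj (Atom a) (Atom b)) None [F]"
    "struct_for F (Atom a) \<or> struct_for F (Atom b)"
    using canonical_DisjE[OF E(2) E'(1)] .
  have "valid UNIV \<BB> F" "closed_struct F"
    using E F E' by (auto simp: struct_for_def)
  then show ?thesis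
    using F(2) valid_UNIV_atomic by blast
qed

text \<open>The premise of a canonical form is instantiated with the axiom node for
  \<open>a\<close>, which is valid once that axiom belongs to the base.\<close>

lemma valid_Impl_Disj_derives:
  assumes "closed_struct D" "concl D = Impl (Atom a) (Disj (Atom b) (Atom c))" "valid UNIV \<BB> D"
    and "atomic_base \<BB>"
  shows "derives (insert (ARule [] a) \<BB>) b \<or> derives (insert (ARule [] a) \<BB>) c"
proof -
  let ?\<CC> = "insert (ARule [] a) \<BB>"
  obtain E where E: "reduces UNIV D E" "canonical E" "\<forall>P\<in>set (immediate_subs E). valid UNIV \<BB> P"
    using assms by (auto simp: valid_closed_nonatomic)
  have E': "concl E = Impl (Atom a) (Disj (Atom b) (Atom c))" "closed_struct E"
    using reduces_preserves[OF E(1)] assms by auto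
  obtain t where t: "E = Node (Impl (Atom a) (Disj (Atom b) (Atom c))) None [t]" "arg_struct E"
    "concl t = Disj (Atom b) (Atom c)" "dis_by 0 t \<subseteq> {Atom a}"
    using canonical_ImplE[OF E(2) E'(1)] .
  define P where "P = prune 0 t"
  have P: "valid UNIV \<BB> P" "concl P = Disj (Atom b) (Atom c)"
    using E(3) t by (auto simp: P_def)
  have "assms_of P \<subseteq> assms_of t \<union> dis_by 0 t"
    using t(1,2) unfolding P_def by (intro assms_of_prune_dis_by) (auto simp: arg_struct_def)
  then have "assms_of P \<subseteq> {Atom a}"
    using t E'(2) by auto
  then consider "assms_of P = {}" | "assms_of P = {Atom a}"
    by blast
  then show ?thesis
  proof cases
    \<comment> \<open>The introduction discharged vacuously, so the disjunction is already valid on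
      \<BB>.\<close>
    case 1
    then show ?thesis
      using valid_Disj_derives P derives_mono by blast
  next
    case 2
    define \<sigma> where "\<sigma> A = Node A None []" for A
    have \<sigma>: "struct_for (\<sigma> A) A" "closed_struct (\<sigma> A)" for A
      by (auto simp: \<sigma>_def struct_for_def arg_struct_def)
    have "valid UNIV ?\<CC> (\<sigma> (Atom a))"
      using valid_UNIV_atomic[OF \<sigma>] derives_axiom by blast
    then have "valid UNIV ?\<CC> (subst \<sigma> P)"
      using P(1) 2 \<sigma> atomic_base_insert[OF assms(4)] by (intro valid_UNIV_subst[of \<BB>]) auto
    moreover have "closed_struct (subst \<sigma> P)" "concl (subst \<sigma> P) = concl P"
      using \<sigma> by (auto simp: struct_for_def intro!: assms_of_subst_closed concl_subst)
    ultimately show ?thesis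
      using valid_Disj_derives P(2) by simp
  qed
qed

lemma valid_Impl_if_derives:
  assumes "derives (insert (ARule [] a) \<BB>) b"
  obtains D where "struct_for D (Impl (Atom a) (Atom b))" "closed_struct D" "valid UNIV \<BB> D"
proof
  \<comment> \<open>The index \<open>Some 1\<close> skips the root of \<open>G\<close> and points to
    the implication introduced below it.\<close>
  define G where "G = Node (Atom b) None [Assm (Atom a) (Some 1)]"
  define D where "D = Node (Impl (Atom a) (Atom b)) None [G]"
  show D: "struct_for D (Impl (Atom a) (Atom b))" "closed_struct D"
    by (auto simp: D_def G_def struct_for_def arg_struct_def)
  \<comment> \<open>This is \<open>prune 0 G\<close>, with the assumption set free. The step from
    \<open>a\<close> to \<open>b\<close> need not be a rule of the base: a closed instance is valid
    because cut makes \<open>b\<close> derivable.\<close>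
  have "valid UNIV \<BB> (Node (Atom b) None [Assm (Atom a) None])"
  proof (rule valid_UNIV_openI, simp_all, elim conjE)
    fix \<sigma> \<CC>
    assume "struct_for (\<sigma> (Atom a)) (Atom a)" "closed_struct (\<sigma> (Atom a))"
      "\<BB> \<subseteq> \<CC>" "valid UNIV \<CC> (\<sigma> (Atom a))"
    moreover from this have "derives \<CC> a"
      using valid_UNIV_atomic by blast
    ultimately have "derives \<CC> b" "struct_for (Node (Atom b) None [\<sigma> (Atom a)]) (Atom b)"
      "closed_struct (Node (Atom b) None [\<sigma> (Atom a)])"
      using derives_cut[OF assms] by (auto simp: struct_for_def intro: arg_struct_Node)
    then show "valid UNIV \<CC> (Node (Atom b) None [\<sigma> (Atom a)])"
      using valid_UNIV_atomic by blast
  qed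
  moreover have "canonical D"
    using D(1) unfolding D_def by (intro intro_rules.impI) (auto simp: struct_for_def G_def)
  ultimately show "valid UNIV \<BB> D"
    using D by (subst valid_closed_nonatomic) (auto simp: D_def G_def)
qed


section \<open>Validity of the disjunction rule for atoms\<close>

definition split_premise :: "atom \<Rightarrow> atom \<Rightarrow> atom \<Rightarrow> formula" where
  "split_premise a b c = Impl (Atom a) (Disj (Atom b) (Atom c))"

definition split_concl :: "atom \<Rightarrow> atom \<Rightarrow> atom \<Rightarrow> formula" where
  "split_concl a b c = Disj (Impl (Atom a) (Atom b)) (Impl (Atom a) (Atom c))"

text \<open>Whichever atom the extended base derives, the matching implication yields a valid
  canonical \<open>E\<close>, to which the given structure reduces because both are closed.\<close>

lemma valid_split_closed:
  assumes "struct_for D (split_premise a b c)" "closed_struct D" "valid UNIV \<BB> D" "atomic_base \<BB>"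
  shows "valid UNIV \<BB> (Node (split_concl a b c) None [D])"
proof -
  have "concl D = Impl (Atom a) (Disj (Atom b) (Atom c))"
    using assms(1) by (simp add: split_premise_def struct_for_def)
  from valid_Impl_Disj_derives[OF assms(2) this assms(3,4)]
  obtain x where x: "x = b \<or> x = c" "derives (insert (ARule [] a) \<BB>) x"
    by metis
  obtain F where F: "struct_for F (Impl (Atom a) (Atom x))" "closed_struct F" "valid UNIV \<BB> F"
    using valid_Impl_if_derives[OF x(2)] .
  define E where "E = Node (split_concl a b c) None [F]"
  have E: "struct_for E (split_concl a b c)" "closed_struct E"
    using F by (auto simp: E_def struct_for_def intro: arg_struct_Node)
  have "canonical E"
    using F(1) x(1) unfolding E_def split_concl_def by (auto intro: intro_rules.intros)
  moreover have "\<forall>P\<in>set (immediate_subs E). valid UNIV \<BB> P"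
    using F by (simp add: E_def struct_for_def)
  moreover have "\<not> is_atomic (concl E)"
    by (simp add: E_def split_concl_def)
  ultimately have "valid UNIV \<BB> E"
    using valid_closed_nonatomic[of E UNIV \<BB>] E(2) by blast
  moreover have "struct_for (Node (split_concl a b c) None [D]) (split_concl a b c)"
    using assms(1) by (auto simp: struct_for_def intro: arg_struct_Node)
  ultimately show ?thesis
    using E assms(2) by (simp add: valid_UNIV_closed[of _ "split_concl a b c" E])
qed

text \<open>Substitution passes through the added root, so each closed instance falls under the
  closed case.\<close>

lemma valid_split:
  assumes "struct_for D (split_premise a b c)" "valid UNIV \<BB> D" "atomic_base \<BB>"
  shows "valid UNIV \<BB> (Node (split_concl a b c) None [D])"
proof (cases "closed_struct D")
  case True
  then show ?thesis
    using assms valid_split_closed by blast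
next
  case False
  have "valid UNIV \<CC> (Node (split_concl a b c) None [subst \<sigma> D])"
    if "\<forall>A\<in>assms_of D. struct_for (\<sigma> A) A \<and> closed_struct (\<sigma> A) \<and> valid UNIV \<CC> (\<sigma> A)"
      "\<BB> \<subseteq> \<CC>" "atomic_base \<CC>" for \<sigma> \<CC>
  proof (rule valid_split_closed)
    show "struct_for (subst \<sigma> D) (split_premise a b c)" "closed_struct (subst \<sigma> D)"
      using that(1) assms(1) by (auto intro!: struct_for_subst assms_of_subst_closed)
    show "valid UNIV \<CC> (subst \<sigma> D)"
      using assms(2) False that by (intro valid_UNIV_subst[of \<BB>]) auto
  qed fact
  then show ?thesis
    using False by (auto simp: valid_UNIV_open)
qed

lemma split_rule_valid:
  "rule_logically_valid (schematic_rule [split_premise a b c] (split_concl a b c)) UNIV"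
proof -
  have "valid H \<CC> D"
    if H: "UNIV \<subseteq> H" "atomic_base \<CC>"
      and D: "D \<in> schematic_rule [split_premise a b c] (split_concl a b c)"
      "\<forall>P\<in>set (immediate_subs D). valid H \<CC> P" for H \<CC> D
  proof -
    obtain E where E: "D = Node (split_concl a b c) None [E]" "struct_for E (split_premise a b c)"
      using D(1) by (auto simp: schematic_rule_def list_all2_Cons2)
    have "H = UNIV"
      using H(1) by blast
    moreover have "valid H \<CC> E"
      using D(2) E by (simp add: struct_for_def)
    ultimately show ?thesis
      using valid_split E H(2) by simp
  qed
  then show ?thesis
    unfolding rule_logically_valid_def rule_valid_def by blast
qed

lemma split_consequence: "{split_premise a b c} \<TTurnstile> split_concl a b c"
proof -
  let ?D = "Node (split_concl a b c) None [Assm (split_premise a b c) None]"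
  have "struct_for ?D (split_concl a b c)" "assms_of ?D = {split_premise a b c}"
    by (auto simp: struct_for_def arg_struct_def)
  moreover have "logically_valid UNIV ?D"
    unfolding logically_valid_def
    by (auto simp: valid_UNIV_open intro!: valid_split_closed)
  ultimately show ?thesis
    unfolding consequence_def by blast
qed


section \<open>A Kripke countermodel\<close>

text \<open>The root \<open>None\<close> lies below the incomparable worlds \<open>Some True\<close> and \<open>Some False\<close>.\<close>

fun kripke :: "bool option \<Rightarrow> formula \<Rightarrow> bool" where
  "kripke w (Atom a) \<longleftrightarrow> w = Some True \<and> a \<in> {Var 0, Var 1} \<or> w = Some False \<and> a \<in> {Var 0, Var 2}"
| "kripke w (Conj A B) \<longleftrightarrow> kripke w A \<and> kripke w B"
| "kripke w (Disj A B) \<longleftrightarrow> kripke w A \<or> kripke w B"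
| "kripke w (Impl A B) \<longleftrightarrow> (\<forall>v. w = None \<or> v = w \<longrightarrow> kripke v A \<longrightarrow> kripke v B)"

lemma kripke_mono: "kripke w A \<Longrightarrow> w = None \<or> v = w \<Longrightarrow> kripke v A"
  by (induction A arbitrary: w v) auto

lemma kripke_sound:
  assumes "derivation {} D" "\<forall>A\<in>assms_of D. kripke w A"
  shows "kripke w (concl D)"
  using assms
proof (induction arbitrary: w)
  case 1
  then show ?case by simp
next
  case (2 D)
  have IH: "kripke v (concl P)"
    if "P \<in> set (immediate_subs D)" "\<forall>A\<in>assms_of P. kripke v A" for P v
    using 2(2) that by blast
  \<comment> \<open>The common core of the discharging rules: pruning a premise frees at most
    \<open>A\<close>, and persistence carries the other assumptions from \<open>w\<close> to
    \<open>v\<close>.\<close>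
  have discharge: "kripke v (concl t)"
    if D: "D = Node C None ts" "arg_struct D" "t \<in> set ts" "dis_by 0 t \<subseteq> {A}"
      and v: "w = None \<or> v = w" "kripke v A" for C ts t A v
  proof -
    have "assms_of (prune 0 t) \<subseteq> assms_of t \<union> dis_by 0 t"
      using D by (intro assms_of_prune_dis_by) (auto simp: arg_struct_def)
    then have "\<forall>B\<in>assms_of (prune 0 t). kripke v B"
      using D v 2(3) kripke_mono[OF _ v(1)] by auto
    then have "kripke v (concl (prune 0 t))"
      using D by (intro IH) auto
    then show ?thesis by simp
  qed
  from 2(1) consider "D \<in> intro_rules" | "D \<in> elim_rules"
    by blast
  then show ?case
  proof cases
    case 1
    then show ?thesis
    proof cases
      case (impI A B t)
      then show ?thesis
        using discharge[of "Impl A B" "[t]" t A] by simp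
    qed (use 2(3) IH in \<open>force simp: struct_for_def\<close>)+
  next
    case elim: 2
    then show ?thesis
    proof cases
      case (disjE C E t u A B)
      then have "arg_struct E"
        by (simp add: struct_for_def)
      then have "kripke w (Disj A B)"
        using IH[of E w] disjE 2(3) by (auto simp: struct_for_def)
      then show ?thesis
        using discharge[of C "[E, t, u]" t A w] discharge[of C "[E, t, u]" u B w] disjE by auto
    next
      case (impE E A B F)
      then have "kripke w (Impl A B)" "kripke w A"
        using IH[of E w] IH[of F w] 2(3) by (auto simp: struct_for_def)
      then show ?thesis
        using impE by simp
    qed (use 2(3) IH in \<open>force simp: struct_for_def\<close>)+
  qed
qed

text \<open>\<open>Var 0\<close> holds exactly at the two upper worlds, one forcing only
  \<open>Var 1\<close> and the other only \<open>Var 2\<close> of the two disjuncts, so each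
  implication in the conclusion fails at one of them.\<close>

lemma split_not_IL:
  "\<not> {split_premise (Var 0) (Var 1) (Var 2)} \<turnstile>\<^sub>I\<^sub>L split_concl (Var 0) (Var 1) (Var 2)"
proof
  assume "{split_premise (Var 0) (Var 1) (Var 2)} \<turnstile>\<^sub>I\<^sub>L split_concl (Var 0) (Var 1) (Var 2)"
  moreover have "kripke None (split_premise (Var 0) (Var 1) (Var 2))"
    by (auto simp: split_premise_def)
  ultimately have "kripke None (split_concl (Var 0) (Var 1) (Var 2))"
    using kripke_sound by (fastforce simp: IL_derives_def IL_ext_derives_def)
  then show False
    by (auto simp: split_concl_def split: if_splits)
qed

text \<open>One application of the rule to bare assumption leaves; derivability of the rule would
  turn it into a derivation in the unextended calculus.\<close>

lemma schematic_rule_derives: "IL_ext_derives (schematic_rule As A) (set As) A"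
proof -
  let ?D = "Node A None (map (\<lambda>B. Assm B None) As)"
  have "?D \<in> schematic_rule As A"
    by (auto simp: schematic_rule_def list_all2_conv_all_nth struct_for_def arg_struct_def)
  then have "derivation (schematic_rule As A) ?D"
    by (intro derivation.intros(2)) (auto intro: derivation.intros(1))
  then show ?thesis
    unfolding IL_ext_derives_def by (intro exI[of _ ?D]) auto
qed

theorem corollary5:
  shows "\<not> (\<forall>R :: astruct set.
            (\<exists>As A. R = schematic_rule As A) \<longrightarrow>
            (\<exists>J :: reduction set. rule_logically_valid R J) \<longrightarrow>
            derivable_in_IL R)
       \<and> \<not> (\<forall>(\<Gamma> :: formula set) A. finite \<Gamma> \<longrightarrow> \<Gamma> \<TTurnstile> A \<longrightarrow> \<Gamma> \<turnstile>\<^sub>I\<^sub>L A)"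
proof -
  let ?P = "split_premise (Var 0) (Var 1) (Var 2)"
  let ?C = "split_concl (Var 0) (Var 1) (Var 2)"
  have "\<not> derivable_in_IL (schematic_rule [?P] ?C)"
    using schematic_rule_derives[of "[?P]" ?C] split_not_IL by (auto simp: derivable_in_IL_def)
  then show ?thesis
    using split_rule_valid split_consequence split_not_IL by blast
qed

end
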